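(* Let $\mathcal{A}$ be a complex unital Banach algebra and let $x_1,x_2,x_3\in\mathcal{A}$ satisfy $$x_1x_2+x_1x_3+x_2x_3=\alpha_1+\alpha_2(x_1+x_2+x_3)\quad\text{and}\quad x_1x_2x_3=\beta(x_1+x_2+x_3)$$ for some $(\alpha_1,\alpha_2,\beta)\in\mathbb{C}^3\setminus\mathcal{M}$, where $$\mathcal{M}=\{(\alpha_1,\alpha_2,0):\alpha_1,\alpha_2\in\mathbb{C},\ \alpha_1\alpha_2\neq0\}\cup\{(\alpha_1,0,0):\alpha_1\in\mathbb{C}\setminus\{0\}\}.$$ Let $X=\{x_1,x_2,x_3,x_1+x_2+x_3\}$. If any three of the four elements of $X$ are generalized Drazin invertible, then the remaining one is also generalized Drazin invertible.
   Context: $\mathcal{A}$ is a complex unital Banach algebra with unit $1$. An element $a\in\mathcal{A}$ is quasinilpotent if its spectral radius is $0$. An element $a\in\mathcal{A}$ is generalized Drazin (g-Drazin) invertible if there exists $b\in\mathcal{A}$ (denoted $a^D$) with $ab=ba$, $bab=b$, and $a(1-ab)$ quasinilpotent. $\mathcal{A}^D$ denotes the set of g-Drazin invertible elements. *)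

theory Defs
  imports "HOL-Analysis.Analysis"
begin

class complex_banach_algebra_1 = real_normed_algebra_1 + banach +
  fixes scaleC :: "complex \<Rightarrow> 'a \<Rightarrow> 'a"
  assumes scaleC_add_right: "scaleC a (x + y) = scaleC a x + scaleC a y"
    and scaleC_add_left: "scaleC (a + b) x = scaleC a x + scaleC b x"
    and scaleC_scaleC: "scaleC a (scaleC b x) = scaleC (a * b) x"
    and scaleC_one: "scaleC 1 x = x"
    and scaleR_scaleC: "scaleR r x = scaleC (complex_of_real r) x"
    and mult_scaleC_left: "scaleC a x * y = scaleC a (x * y)"
    and mult_scaleC_right: "x * scaleC a y = scaleC a (x * y)"
    and norm_scaleC: "norm (scaleC a x) = cmod a * norm x"

definition invertible_el :: "'a::complex_banach_algebra_1 \<Rightarrow> bool" where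
  "invertible_el a \<longleftrightarrow> (\<exists>b. a * b = 1 \<and> b * a = 1)"

definition spectrum_el :: "'a::complex_banach_algebra_1 \<Rightarrow> complex set" where
  "spectrum_el a = {z. \<not> invertible_el (scaleC z 1 - a)}"

definition spectral_radius_el :: "'a::complex_banach_algebra_1 \<Rightarrow> real" where
  "spectral_radius_el a = Sup (cmod ` spectrum_el a)"

definition quasinilpotent :: "'a::complex_banach_algebra_1 \<Rightarrow> bool" where
  "quasinilpotent a \<longleftrightarrow> spectral_radius_el a = 0"

definition gDrazin_inverse :: "'a::complex_banach_algebra_1 \<Rightarrow> 'a \<Rightarrow> bool" where
  "gDrazin_inverse a b \<longleftrightarrow> a * b = b * a \<and> b * a * b = b \<and> quasinilpotent (a * (1 - a * b))"

definition gDrazin_invertible :: "'a::complex_banach_algebra_1 \<Rightarrow> bool" where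
  "gDrazin_invertible a \<longleftrightarrow> (\<exists>b. gDrazin_inverse a b)"

definition M_set :: "(complex \<times> complex \<times> complex) set" where
  "M_set = {(a1, a2, 0) | a1 a2. a1 * a2 \<noteq> 0} \<union> {(a1, 0, 0) | a1. a1 \<noteq> 0}"

end

theory Submission
  imports Defs "HOL-Complex_Analysis.Complex_Analysis"
begin

text \<open>
  An element \<open>a\<close> is g-Drazin invertible iff \<open>z - a\<close> is invertible for all small \<open>z \<noteq> 0\<close>. With
  \<open>s = x1 + x2 + x3\<close> the two hypotheses turn \<open>(z - x1) (z - x2) (z - x3)\<close> into
  \<open>z\<^sup>3 + \<alpha>1 z - (z\<^sup>2 - \<alpha>2 z + \<beta>) s = q(z) (f(z) - s)\<close>, where \<open>q(z) = z\<^sup>2 - \<alpha>2 z + \<beta>\<close> and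
  \<open>f(z) = (z\<^sup>3 + \<alpha>1 z) / q(z)\<close>. Excluding \<open>\<M>\<close> means exactly that \<open>f\<close> is holomorphic near \<open>0\<close> with
  \<open>f(0) = 0\<close>; it is not constant, hence open, and so small values of \<open>z\<close> correspond to small values
  of \<open>f(z)\<close>.

  The spectral idempotent at an isolated point of the spectrum is obtained without vector-valued
  integration: \<open>(1 - (a / \<rho>)\<^sup>n)\<^sup>-\<^sup>1\<close> is the average of \<open>(1 - a / w)\<^sup>-\<^sup>1\<close> over the \<open>n\<close>-th roots
  \<open>w\<close> of \<open>\<rho>\<^sup>n\<close>, hence converges for \<open>n \<rightarrow> \<infinity>\<close>. Partial fractions for two radii
  \<open>\<rho> < \<sigma>\<close> give \<open>P(\<rho>) P(\<sigma>) = P(\<rho>)\<close> for the limits, and \<open>\<sigma> \<rightarrow> \<rho>\<close> shows that \<open>P(\<rho>)\<close> is idempotent.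
\<close>

section \<open>Complex scalars and inverses in a Banach algebra\<close>

definition of_complex :: "complex \<Rightarrow> 'a::complex_banach_algebra_1" where
  "of_complex z = scaleC z 1"

lemma scaleC_conv_of_complex: "scaleC z x = of_complex z * x"
  by (simp add: of_complex_def mult_scaleC_left scaleC_one)

lemma of_complex_commute: "of_complex z * x = x * of_complex z"
  by (simp add: of_complex_def mult_scaleC_left mult_scaleC_right)

lemma of_complex_left_commute: "x * (of_complex z * y) = of_complex z * (x * y)"
  by (metis of_complex_commute mult.assoc)

lemma of_complex_1 [simp]: "of_complex 1 = 1"
  by (simp add: of_complex_def scaleC_one)

lemma of_complex_add: "of_complex (z + w) = of_complex z + of_complex w"
  by (simp add: of_complex_def scaleC_add_left)

lemma of_complex_0 [simp]: "of_complex 0 = 0"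
  using of_complex_add[of 0 0] by simp

lemma of_complex_minus: "of_complex (- z) = - of_complex z"
  using of_complex_add[of z "- z"] by (simp add: eq_neg_iff_add_eq_0 add.commute)

lemma of_complex_diff: "of_complex (z - w) = of_complex z - of_complex w"
  using of_complex_add[of z "- w"] by (simp add: of_complex_minus)

lemma of_complex_mult: "of_complex (z * w) = of_complex z * of_complex w"
  by (simp add: of_complex_def mult_scaleC_left scaleC_scaleC)

lemma of_complex_of_nat: "of_complex (of_nat n) = of_nat n"
  by (induction n) (simp_all add: of_complex_add)

lemma of_complex_sum: "of_complex (sum f A) = (\<Sum>x\<in>A. of_complex (f x))"
  by (induction A rule: infinite_finite_induct) (simp_all add: of_complex_add)

lemma norm_of_complex [simp]: "norm (of_complex z :: 'a::complex_banach_algebra_1) = cmod z"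
  by (simp add: of_complex_def norm_scaleC)

lemma bounded_linear_of_complex:
  "bounded_linear (of_complex :: complex \<Rightarrow> 'a::complex_banach_algebra_1)"
proof (rule bounded_linear_intro[where K = 1])
  show "of_complex (r *\<^sub>R z) = r *\<^sub>R (of_complex z :: 'a)" for r z
    by (simp add: of_complex_def scaleR_scaleC scaleC_scaleC scaleR_conv_of_real)
qed (simp_all add: of_complex_add)

lemmas tendsto_of_complex = bounded_linear.tendsto[OF bounded_linear_of_complex]
lemmas continuous_on_of_complex = bounded_linear.continuous_on[OF bounded_linear_of_complex]

lemma power_mult_of_complex: "(of_complex z * x) ^ n = of_complex (z ^ n) * x ^ n"
proof (induction n)
  case (Suc n)
  have "of_complex z * x * (of_complex (z ^ n) * x ^ n) = of_complex z * (of_complex (z ^ n) * (x * x ^ n))"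
    by (simp only: mult.assoc of_complex_left_commute[of x])
  then show ?case by (simp add: Suc of_complex_mult mult.assoc)
qed simp

lemma power_mult_distrib_commuting:
  fixes x y :: "'b::monoid_mult"
  assumes "x * y = y * x"
  shows "(x * y) ^ n = x ^ n * y ^ n"
proof (induction n)
  case (Suc n)
  have "(x * y) ^ Suc n = x * (y * x ^ n) * y ^ n" by (simp add: Suc mult.assoc)
  also have "y * x ^ n = x ^ n * y" using assms by (simp add: power_commuting_commutes)
  finally show ?case by (simp add: mult.assoc)
qed simp

section \<open>Two-sided inverses and cancellation of factors\<close>

lemma invertible_elI: "x * y = 1 \<Longrightarrow> y * x = 1 \<Longrightarrow> invertible_el x"
  by (auto simp: invertible_el_def)

lemma invertible_el_if_left_right:
  assumes "x * y = 1" "z * x = 1"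
  shows "invertible_el x"
proof -
  have "z = z * (x * y)" using assms by simp
  also have "\<dots> = y" using assms by (metis mult.assoc mult_1_left)
  finally show ?thesis using assms by (auto simp: invertible_el_def)
qed

text \<open>Two-sided inverses are unique, so the choice is forced when \<open>x\<close> is
  invertible; for other \<open>x\<close> the value is unspecified.\<close>

definition inv_el :: "'a::complex_banach_algebra_1 \<Rightarrow> 'a" where
  "inv_el x = (SOME y. x * y = 1 \<and> y * x = 1)"

lemma inv_el:
  assumes "invertible_el x"
  shows inv_el_right: "x * inv_el x = 1" and inv_el_left: "inv_el x * x = 1"
  using someI_ex[of "\<lambda>y. x * y = 1 \<and> y * x = 1"] assms
  by (auto simp: inv_el_def invertible_el_def)

lemma inv_el_commute:
  assumes "invertible_el x" "x * y = y * x"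
  shows "inv_el x * y = y * inv_el x"
proof -
  have "inv_el x * y = inv_el x * y * (x * inv_el x)"
    by (simp add: inv_el_right assms)
  also have "\<dots> = inv_el x * (x * y) * inv_el x"
    by (simp add: assms mult.assoc)
  also have "\<dots> = y * inv_el x"
    using assms by (metis inv_el_left mult.assoc mult_1_left)
  finally show ?thesis .
qed

lemma invertible_el_inv_el: "invertible_el x \<Longrightarrow> invertible_el (inv_el x)"
  by (rule invertible_elI[of _ x]) (simp_all add: inv_el)

lemma invertible_el_mult:
  assumes "invertible_el x" "invertible_el y"
  shows "invertible_el (x * y)"
proof (rule invertible_elI)
  show "x * y * (inv_el y * inv_el x) = 1"
    by (metis assms inv_el_right mult.assoc mult.right_neutral)
  show "inv_el y * inv_el x * (x * y) = 1"
    by (metis assms inv_el_left mult.assoc mult.right_neutral)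
qed

lemma invertible_el_mult_iff_right:
  assumes "invertible_el x"
  shows "invertible_el (x * y) \<longleftrightarrow> invertible_el y"
proof
  assume "invertible_el (x * y)"
  then have "invertible_el (inv_el x * (x * y))"
    using assms invertible_el_inv_el invertible_el_mult by blast
  then show "invertible_el y"
    by (simp add: inv_el_left assms flip: mult.assoc)
qed (use assms invertible_el_mult in blast)

lemma invertible_el_mult_iff_left:
  assumes "invertible_el y"
  shows "invertible_el (x * y) \<longleftrightarrow> invertible_el x"
proof
  assume "invertible_el (x * y)"
  then have "invertible_el (x * y * inv_el y)"
    using assms invertible_el_inv_el invertible_el_mult by blast
  then show "invertible_el x"
    by (simp add: inv_el_right assms mult.assoc)
qed (use assms invertible_el_mult in blast)

text \<open>The inverse of the product, multiplied by \<open>y\<close>, is a right inverse of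
  \<open>x\<close>; commutation of \<open>x\<close> and \<open>y\<close> supplies a left inverse as
  well.\<close>

lemma invertible_el_factor:
  assumes "invertible_el (x * y)" "x * y = y * x"
  shows "invertible_el x"
proof (rule invertible_el_if_left_right)
  show "x * (y * inv_el (x * y)) = 1"
    using inv_el_right[OF assms(1)] by (simp add: mult.assoc)
  show "inv_el (x * y) * y * x = 1"
    using inv_el_left[OF assms(1)] by (simp add: mult.assoc assms(2))
qed

lemma invertible_of_complex: "z \<noteq> 0 \<Longrightarrow> invertible_el (of_complex z)"
  by (rule invertible_elI[of _ "of_complex (1 / z)"]) (simp_all flip: of_complex_mult)

lemma not_invertible_el_0: "\<not> invertible_el 0"
  by (simp add: invertible_el_def)

section \<open>Neumann series, geometric sums and continuity of inversion\<close>

lemma invertible_el_Neumann: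
  fixes x :: "'a::complex_banach_algebra_1"
  assumes "norm x < 1"
  shows "invertible_el (1 - x)"
proof -
  have s: "summable (\<lambda>n. x ^ n)"
    by (rule complete_algebra_summable_geometric[OF assms])
  define S where "S = (\<Sum>n. x ^ n)"
  have split: "(\<Sum>n. x ^ Suc n) = S - 1"
    using suminf_split_head[OF s] by (simp add: S_def)
  have "x * S = S - 1"
    using suminf_mult[OF s, of x] split by (simp add: S_def)
  moreover have "S * x = S - 1"
    using suminf_mult2[OF s, of x] split by (simp add: S_def power_commutes)
  ultimately show ?thesis
    by (intro invertible_elI[of _ S]) (simp_all add: algebra_simps)
qed

lemma geometric_sum_mult:
  fixes x :: "'a::ring_1"
  shows "(1 - x) * (\<Sum>k<n. x ^ k) = 1 - x ^ n"
proof (induction n)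
  case (Suc n)
  have "(1 - x) * (\<Sum>k<Suc n. x ^ k) = (1 - x) * (\<Sum>k<n. x ^ k) + (1 - x) * x ^ n"
    by (simp add: distrib_left)
  also have "\<dots> = 1 - x ^ Suc n"
    by (simp only: Suc) (simp add: left_diff_distrib)
  finally show ?case .
qed simp

text \<open>\<open>1 - x\<close> divides \<open>1 - x ^ n\<close>, and the cofactor, a geometric
  sum, commutes with it.\<close>

lemma invertible_el_1_minus_if_power:
  assumes "invertible_el (1 - x ^ n)"
  shows "invertible_el (1 - x)"
proof (rule invertible_el_factor)
  have "x * (\<Sum>k<n. x ^ k) = (\<Sum>k<n. x ^ k) * x"
    by (simp add: sum_distrib_left sum_distrib_right power_commutes)
  then show "(1 - x) * (\<Sum>k<n. x ^ k) = (\<Sum>k<n. x ^ k) * (1 - x)"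
    by (simp add: algebra_simps)
  show "invertible_el ((1 - x) * (\<Sum>k<n. x ^ k))"
    using assms by (simp add: geometric_sum_mult)
qed

lemma inv_el_diff:
  assumes "invertible_el x" "invertible_el y"
  shows "inv_el x - inv_el y = inv_el x * (y - x) * inv_el y"
  using assms by (simp add: algebra_simps inv_el)

text \<open>The formula \<open>inv_el_diff\<close> bounds the increment by
  \<open>norm (inv_el x) * norm (x - y) * norm (inv_el y)\<close>; near \<open>x\<close> the last
  factor is at most \<open>2 * norm (inv_el x)\<close>.\<close>

lemma continuous_on_inv_el: "continuous_on {x. invertible_el x} inv_el"
  unfolding continuous_on_def
proof safe
  fix x :: 'a assume x: "invertible_el x"
  let ?F = "at x within {x. invertible_el x}"
  have inv: "\<forall>\<^sub>F y in ?F. invertible_el y"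
    by (auto simp: eventually_at_filter)
  have "((\<lambda>y. norm (inv_el x) * norm (x - y)) \<longlongrightarrow> norm (inv_el x) * norm (x - x)) ?F"
    by (intro tendsto_intros)
  then have "\<forall>\<^sub>F y in ?F. norm (inv_el x) * norm (x - y) < 1 / 2"
    by (rule order_tendstoD) simp
  with inv have "\<forall>\<^sub>F y in ?F. norm (inv_el y - inv_el x) \<le> 2 * norm (inv_el x) ^ 2 * norm (x - y)"
  proof eventually_elim
    case (elim y)
    let ?d = "norm (x - y)" and ?X = "norm (inv_el x)" and ?Y = "norm (inv_el y)"
    have "norm (inv_el y - inv_el x) = norm (inv_el x * (y - x) * inv_el y)"
      using inv_el_diff[OF x elim(1)] norm_minus_commute by metis
    also have "\<dots> \<le> ?X * norm (y - x) * ?Y"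
      by (meson norm_mult_ineq mult_right_mono norm_ge_zero order_trans)
    also have "\<dots> = ?X * ?d * ?Y" by (simp add: norm_minus_commute)
    finally have le: "norm (inv_el y - inv_el x) \<le> ?X * ?d * ?Y" .
    have "?Y \<le> ?X + norm (inv_el y - inv_el x)"
      using norm_triangle_sub by blast
    also have "\<dots> \<le> ?X + 1/2 * ?Y"
      using le elim(2) mult_right_mono[of "?X * ?d" "1/2" ?Y] by simp
    finally have "?Y \<le> 2 * ?X" by simp
    with le show ?case
      using mult_left_mono[of ?Y "2 * ?X" "?X * ?d"]
      by (simp add: power2_eq_square algebra_simps)
  qed
  moreover have "((\<lambda>y. 2 * norm (inv_el x) ^ 2 * norm (x - y)) \<longlongrightarrow> 2 * norm (inv_el x) ^ 2 * norm (x - x)) ?F"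
    by (intro tendsto_intros)
  ultimately have "((\<lambda>y. inv_el y - inv_el x) \<longlongrightarrow> 0) ?F"
    using Lim_null_comparison by fastforce
  then show "(inv_el \<longlongrightarrow> inv_el x) ?F"
    by (simp add: LIM_zero_iff)
qed

section \<open>Quasinilpotent elements\<close>

lemma invertible_el_1_minus_iff:
  assumes "z \<noteq> 0"
  shows "invertible_el (1 - of_complex (1 / z) * a) \<longleftrightarrow> invertible_el (of_complex z - a)"
proof -
  have "of_complex z - a = of_complex z * (1 - of_complex (1 / z) * a)"
    using assms by (simp add: algebra_simps flip: of_complex_mult mult.assoc)
  then show ?thesis
    by (simp add: assms invertible_el_mult_iff_right invertible_of_complex)
qed

text \<open>Boundedness makes the \<open>Sup\<close> in \<open>spectral_radius_el\<close> an upper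
  bound for the moduli of all spectral values.\<close>

lemma spectrum_el_bdd_above: "bdd_above (cmod ` spectrum_el a)"
proof (rule bdd_aboveI2)
  fix z assume z: "z \<in> spectrum_el a"
  show "cmod z \<le> norm a"
  proof (rule ccontr)
    assume "\<not> cmod z \<le> norm a"
    then have "z \<noteq> 0" and "norm a / cmod z < 1"
      by (auto simp: divide_simps)
    moreover have "norm (of_complex (1 / z) * a) \<le> norm a / cmod z"
      using norm_mult_ineq[of "of_complex (1 / z)" a] by (simp add: norm_divide)
    ultimately have "norm (of_complex (1 / z) * a) < 1" by linarith
    then have "invertible_el (of_complex z - a)"
      using \<open>z \<noteq> 0\<close> invertible_el_1_minus_iff invertible_el_Neumann by blast
    with z show False by (simp add: spectrum_el_def of_complex_def)
  qed
qed

lemma quasinilpotent_imp_invertible: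
  assumes "quasinilpotent a" "z \<noteq> 0"
  shows "invertible_el (of_complex z - a)"
proof (rule ccontr)
  assume "\<not> ?thesis"
  then have "z \<in> spectrum_el a" by (simp add: spectrum_el_def of_complex_def)
  then have "cmod z \<le> 0"
    using cSup_upper[OF _ spectrum_el_bdd_above[of a], of "cmod z"] assms
    by (simp add: quasinilpotent_def spectral_radius_el_def)
  with assms show False by simp
qed

text \<open>Non-invertibility of \<open>a\<close> puts 0 into the spectrum, which is then
  \<open>{0}\<close>, so the \<open>Sup\<close> ranges over a nonempty set.\<close>

lemma quasinilpotentI:
  assumes "\<And>z. z \<noteq> 0 \<Longrightarrow> invertible_el (of_complex z - a)" "\<not> invertible_el a"
  shows "quasinilpotent a"
proof -
  have "invertible_el (- a) \<longleftrightarrow> invertible_el a"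
    by (metis invertible_el_mult_iff_right invertible_of_complex mult_minus1 of_complex_1
        of_complex_minus zero_neq_neg_one)
  then have "spectrum_el a = {0}"
    using assms by (auto simp: spectrum_el_def simp flip: of_complex_def)
  then show ?thesis by (simp add: quasinilpotent_def spectral_radius_el_def)
qed

section \<open>Averages of the resolvent over circles\<close>

text \<open>Left Riemann sums: by uniform continuity a fine one is close to all its refinements, and
  the sums with \<open>m\<close> and \<open>n\<close> nodes share the refinement with
  \<open>m * n\<close> nodes.\<close>

lemma riemann_average_convergent:
  fixes f :: "real \<Rightarrow> 'b::banach"
  assumes "continuous_on {0..1} f"
  shows "convergent (\<lambda>n. (1 / real n) *\<^sub>R (\<Sum>k<n. f (real k / real n)))"
proof -
  define A where "A n = (1 / real n) *\<^sub>R (\<Sum>k<n. f (real k / real n))" for n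
  have uc: "uniformly_continuous_on {0..1} f"
    using assms by (rule compact_uniformly_continuous) simp
  have refine: "\<exists>N>0. \<forall>n\<ge>N. \<forall>m>0. dist (A n) (A (n * m)) \<le> e" if "e > 0" for e
  proof -
    obtain d where "d > 0"
      and d: "\<And>x y. x \<in> {0..1} \<Longrightarrow> y \<in> {0..1} \<Longrightarrow> dist y x < d \<Longrightarrow> dist (f y) (f x) < e"
      using uc \<open>e > 0\<close> unfolding uniformly_continuous_on_def by metis
    obtain N where N: "N > 0" "1 / real N < d"
      using \<open>d > 0\<close> by (metis inverse_eq_divide real_arch_inverse neq0_conv of_nat_0_less_iff)
    have "dist (A n) (A (n * m)) \<le> e" if "n \<ge> N" "m > 0" for n m
    proof -
      have n: "n > 0" "1 / real n < d"
        using N that by (auto intro: le_less_trans[OF _ N(2)] simp: frac_le)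
      \<comment> \<open>Each value is repeated \<open>m\<close> times, so that both sums run over
        the same \<open>n\<close> blocks of \<open>m\<close> nodes.\<close>
      have "A n = (1 / real (n * m)) *\<^sub>R (\<Sum>k<n. \<Sum>i\<in>{k*m..<k*m+m}. f (real k / real n))"
        using n \<open>m > 0\<close> by (simp add: A_def sum_constant_scaleR flip: scaleR_sum_right)
      moreover have "A (n * m) = (1 / real (n * m)) *\<^sub>R
          (\<Sum>k<n. \<Sum>i\<in>{k*m..<k*m+m}. f (real i / real (n * m)))"
        by (simp add: A_def sum.nat_group)
      ultimately have "dist (A n) (A (n * m)) = (1 / real (n * m)) *
          norm (\<Sum>k<n. \<Sum>i\<in>{k*m..<k*m+m}. f (real k / real n) - f (real i / real (n * m)))"
        by (simp add: dist_norm sum_subtractf flip: scaleR_diff_right)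
      also have "\<dots> \<le> (1 / real (n * m)) * (\<Sum>k<n. \<Sum>i\<in>{k*m..<k*m+m}. e)"
      proof (intro mult_left_mono sum_norm_le)
        fix k i assume ki: "k \<in> {..<n}" "i \<in> {k*m..<k*m+m}"
        have "i < (k + 1) * m" using ki by simp
        also have "\<dots> \<le> n * m" using ki by (intro mult_le_mono1) simp
        finally have "i \<le> n * m" by simp
        have "real i / real (n * m) - real k / real n = (real i - real (k * m)) / real (n * m)"
          using n \<open>m > 0\<close> by (simp add: field_simps)
        moreover have "\<dots> \<le> real m / real (n * m)" "\<dots> \<ge> 0"
          using ki unfolding atLeastLessThan_iff
          by (auto intro!: divide_right_mono divide_nonneg_nonneg simp del: of_nat_mult)
        ultimately have "dist (real k / real n) (real i / real (n * m)) < d"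
          using n \<open>m > 0\<close> by (simp add: dist_real_def)
        moreover have "real k / real n \<in> {0..1}" "real i / real (n * m) \<in> {0..1}"
          using ki \<open>i \<le> n * m\<close> n \<open>m > 0\<close> by (auto simp: divide_simps simp flip: of_nat_mult)
        ultimately show "norm (f (real k / real n) - f (real i / real (n * m))) \<le> e"
          using d by (simp add: dist_norm less_imp_le)
      qed simp
      also have "\<dots> = e" using n \<open>m > 0\<close> by simp
      finally show ?thesis .
    qed
    with N show ?thesis by blast
  qed
  have "Cauchy A"
  proof (rule metric_CauchyI)
    fix e :: real assume "e > 0"
    obtain N where N: "N > 0" "\<And>n m. n \<ge> N \<Longrightarrow> m > 0 \<Longrightarrow> dist (A n) (A (n * m)) \<le> e / 3"
      using refine[of "e / 3"] \<open>e > 0\<close> by auto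
    have "dist (A m) (A n) < e" if "m \<ge> N" "n \<ge> N" for m n
    proof -
      have "dist (A m) (A n) \<le> dist (A m) (A (m * n)) + dist (A n) (A (n * m))"
        by (metis dist_triangle2 mult.commute)
      also have "\<dots> \<le> e / 3 + e / 3"
        using that N by (intro add_mono) auto
      finally show ?thesis using \<open>e > 0\<close> by simp
    qed
    then show "\<exists>M. \<forall>m\<ge>M. \<forall>n\<ge>M. dist (A m) (A n) < e" by blast
  qed
  then show ?thesis by (simp add: Cauchy_convergent_iff A_def[abs_def])
qed

text \<open>As \<open>(1 - a / w)^-1 = w (w - a)^-1\<close>, this is a Riemann sum for the Riesz
  projection: the integral of \<open>(w - a)^-1\<close> over the circle of radius
  \<open>\<rho>\<close>, divided by \<open>2 pi i\<close>. For \<open>n = 0\<close> the value is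
  0.\<close>

definition resolvent_average :: "'a::complex_banach_algebra_1 \<Rightarrow> real \<Rightarrow> nat \<Rightarrow> 'a" where
  "resolvent_average a \<rho> n = (1 / real n) *\<^sub>R
     (\<Sum>k<n. inv_el (1 - of_complex (1 / (of_real \<rho> * cis (2 * pi * (real k / real n)))) * a))"

lemma resolvent_average_commute:
  assumes "\<And>w. cmod w = \<rho> \<Longrightarrow> invertible_el (1 - of_complex (1 / w) * a)" "\<rho> > 0"
    and "a * b = b * a"
  shows "resolvent_average a \<rho> n * b = b * resolvent_average a \<rho> n"
proof -
  have "inv_el (1 - of_complex (1 / w) * a) * b = b * inv_el (1 - of_complex (1 / w) * a)"
    if "cmod w = \<rho>" for w
    using that assms
    by (intro inv_el_commute) (simp_all add: algebra_simps of_complex_left_commute[of b])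
  then show ?thesis
    using assms(2) by (simp add: resolvent_average_def sum_distrib_left sum_distrib_right norm_mult)
qed

text \<open>Put \<open>t = a / \<rho>\<close>. The elements \<open>x = t / \<omega>^k\<close> all
  satisfy \<open>x ^ n = t ^ n\<close>, so multiplying \<open>(1 - x)^-1\<close> by
  \<open>1 - t ^ n\<close> leaves a geometric sum in \<open>x\<close>. Summed over \<open>k\<close>,
  all powers of \<open>t\<close> except \<open>t ^ 0\<close> cancel by orthogonality of the roots of
  unity.\<close>

lemma resolvent_average_inverse:
  fixes a :: "'a::complex_banach_algebra_1"
  assumes inv: "\<And>w. cmod w = \<rho> \<Longrightarrow> invertible_el (1 - of_complex (1 / w) * a)"
    and \<rho>: "\<rho> > 0" and n: "n > 0"
  shows "resolvent_average a \<rho> n * (1 - (of_complex (1 / of_real \<rho>) * a) ^ n) = 1"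
proof -
  define \<omega> where "\<omega> = cis (2 * pi / real n)"
  define t where "t = of_complex (1 / of_real \<rho>) * a"
  have \<omega>_power: "cis (2 * pi * (real k / real n)) = \<omega> ^ k" for k
    by (simp add: \<omega>_def Complex.DeMoivre mult_ac del: of_nat_mult)
  have \<omega>_n: "\<omega> ^ n = 1" using \<omega>_power[of n] n by simp
  have \<omega>_nz: "\<omega> \<noteq> 0" by (simp add: \<omega>_def)
  have sum_\<omega>: "(\<Sum>k<n. ((1 / \<omega>) ^ j) ^ k) = (if j = 0 then of_nat n else 0)" if "j < n" for j
  proof (cases "j = 0")
    case False
    have "inj_on (\<lambda>k. cis (2 * pi * real k / real n)) {..<n}"
      using Complex.bij_betw_roots_unity[OF n] by (rule bij_betw_imp_inj_on)
    then have "\<omega> ^ j \<noteq> 1"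
      using that n False inj_onD[of _ _ j 0] \<omega>_power[of j] by fastforce
    then have "(1 / \<omega>) ^ j \<noteq> 1" by (simp add: power_divide)
    moreover have "((1 / \<omega>) ^ j) ^ n = 1"
      by (metis \<omega>_n div_by_1 mult.commute power_mult power_one power_one_over)
    ultimately show ?thesis using False by (simp add: geometric_sum)
  qed simp
  have summand: "inv_el (1 - of_complex (1 / (of_real \<rho> * \<omega> ^ k)) * a) * (1 - t ^ n) =
      (\<Sum>j<n. of_complex (((1 / \<omega>) ^ j) ^ k) * t ^ j)" for k
  proof -
    define x where "x = of_complex (1 / (of_real \<rho> * \<omega> ^ k)) * a"
    have x: "x = of_complex ((1 / \<omega>) ^ k) * t"
      by (simp add: x_def t_def power_divide mult.commute flip: of_complex_mult mult.assoc)
    have x_power: "x ^ j = of_complex (((1 / \<omega>) ^ j) ^ k) * t ^ j" for j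
      by (simp add: x power_mult_of_complex mult.commute flip: power_mult)
    have "invertible_el (1 - x)"
      using \<rho> by (auto simp: x_def \<omega>_def norm_mult norm_power intro!: inv)
    moreover have "x ^ n = t ^ n"
      using x_power[of n] \<omega>_n by (simp add: power_divide)
    then have "1 - t ^ n = (1 - x) * (\<Sum>j<n. x ^ j)"
      by (simp add: geometric_sum_mult)
    ultimately have "inv_el (1 - x) * (1 - t ^ n) = (\<Sum>j<n. x ^ j)"
      by (metis inv_el_left mult.assoc mult_1_left)
    then show ?thesis unfolding x_power by (simp add: x_def)
  qed
  have "(\<Sum>k<n. inv_el (1 - of_complex (1 / (of_real \<rho> * \<omega> ^ k)) * a)) * (1 - t ^ n) =
      (\<Sum>k<n. \<Sum>j<n. of_complex (((1 / \<omega>) ^ j) ^ k) * t ^ j)"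
    by (simp add: sum_distrib_right summand)
  also have "\<dots> = (\<Sum>j<n. of_complex (\<Sum>k<n. ((1 / \<omega>) ^ j) ^ k) * t ^ j)"
    by (subst sum.swap) (simp add: of_complex_sum sum_distrib_right)
  also have "\<dots> = (\<Sum>j<n. if j = 0 then of_nat n else 0)"
    by (intro sum.cong refl) (simp add: sum_\<omega> of_complex_of_nat del: power_one_over)
  also have "\<dots> = of_nat n" using n by simp
  finally have "resolvent_average a \<rho> n * (1 - t ^ n) = (1 / real n) *\<^sub>R of_nat n"
    unfolding resolvent_average_def \<omega>_power mult_scaleR_left by (rule arg_cong)
  also have "of_nat n = real n *\<^sub>R (1 :: 'a)" by (simp add: scaleR_conv_of_real)
  finally show ?thesis using n by (simp add: t_def)
qed

text \<open>With \<open>A = (a / \<rho>)^n\<close> and \<open>c * A = (a / \<sigma>)^n\<close> this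
  is the partial fraction identity
  \<open>(1 - c) / ((1 - A) (1 - c A)) = 1 / (1 - A) - c / (1 - c A)\<close>, obtained by
  eliminating \<open>?u * (A * ?v)\<close> from two expansions.\<close>

lemma resolvent_average_mult:
  fixes a :: "'a::complex_banach_algebra_1"
  assumes inv: "\<And>w. \<rho> \<le> cmod w \<Longrightarrow> cmod w \<le> \<sigma> \<Longrightarrow> invertible_el (1 - of_complex (1 / w) * a)"
    and \<rho>: "0 < \<rho>" "\<rho> < \<sigma>" and n: "n > 0"
  defines "c \<equiv> of_complex (of_real ((\<rho> / \<sigma>) ^ n))"
  shows "(1 - c) * (resolvent_average a \<rho> n * resolvent_average a \<sigma> n) =
    resolvent_average a \<rho> n - c * resolvent_average a \<sigma> n"
proof -
  let ?u = "resolvent_average a \<rho> n" and ?v = "resolvent_average a \<sigma> n"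
  define A where "A = (of_complex (1 / of_real \<rho>) * a) ^ n"
  define B where "B = (of_complex (1 / of_real \<sigma>) * a) ^ n"
  have u: "?u * (1 - A) = 1"
    unfolding A_def using inv \<rho> n by (intro resolvent_average_inverse) auto
  have "?v * (1 - B) = 1"
    unfolding B_def using inv \<rho> n by (intro resolvent_average_inverse) auto
  \<comment> \<open>\<open>?v\<close> has to stand to the right of \<open>1 - B\<close>, so that
    \<open>(1 - B) * ?v\<close> can be inserted after \<open>?u\<close>.\<close>
  moreover have "?v * (1 - B) = (1 - B) * ?v"
    using inv \<rho> by (intro resolvent_average_commute)
      (auto simp: B_def power_mult_of_complex left_diff_distrib right_diff_distrib mult.assoc
        power_commutes of_complex_left_commute[of a])
  ultimately have v: "(1 - B) * ?v = 1" by simp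
  have B: "B = c * A"
    using \<rho> by (simp add: A_def B_def c_def power_mult_of_complex power_divide field_simps
        flip: of_complex_mult mult.assoc)
  have "?u = ?u * ((1 - B) * ?v)" by (simp add: v)
  also have "\<dots> = ?u * ?v - c * (?u * (A * ?v))"
    unfolding B c_def by (simp add: algebra_simps of_complex_left_commute[of ?u])
  finally have 1: "?u = ?u * ?v - c * (?u * (A * ?v))" .
  have "?v = ?u * (1 - A) * ?v" by (simp add: u)
  also have "\<dots> = ?u * ?v - ?u * (A * ?v)" by (simp add: algebra_simps)
  finally have 2: "?v = ?u * ?v - ?u * (A * ?v)" .
  have "?u - c * ?v = (?u * ?v - c * (?u * (A * ?v))) - c * (?u * ?v - ?u * (A * ?v))"
    using 1 2 by metis
  then show ?thesis by (simp add: algebra_simps)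
qed

lemma spectral_idempotent_exists:
  fixes a :: "'a::complex_banach_algebra_1"
  assumes r: "r > 0"
    and inv: "\<And>z. z \<noteq> 0 \<Longrightarrow> cmod z < r \<Longrightarrow> invertible_el (of_complex z - a)"
  obtains \<rho> P where "0 < \<rho>" "\<rho> < r" "resolvent_average a \<rho> \<longlonglongrightarrow> P" "P * P = P"
proof -
  \<comment> \<open>The closed annulus \<open>K\<close> between two radii inside the punctured disc
    is compact, so \<open>G\<close> is uniformly continuous on it.\<close>
  define \<rho> \<tau> where "\<rho> = r / 3" and "\<tau> = 2 * r / 3"
  have \<rho>\<tau>: "0 < \<rho>" "\<rho> < \<tau>" "\<tau> < r" using r by (simp_all add: \<rho>_def \<tau>_def)
  define G where "G w = inv_el (1 - of_complex (1 / w) * a)" for w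
  define K where "K = cball (0::complex) \<tau> - ball 0 \<rho>"
  have K: "w \<in> K \<longleftrightarrow> \<rho> \<le> cmod w \<and> cmod w \<le> \<tau>" for w by (auto simp: K_def)
  have inv': "invertible_el (1 - of_complex (1 / w) * a)" if "\<rho> \<le> cmod w" "cmod w \<le> \<tau>" for w
  proof -
    have "w \<noteq> 0" using that \<rho>\<tau> by auto
    then show ?thesis using inv[of w] that \<rho>\<tau> by (simp add: invertible_el_1_minus_iff)
  qed
  have contG: "continuous_on K G"
    unfolding G_def
  proof (rule continuous_on_compose2[OF continuous_on_inv_el])
    show "continuous_on K (\<lambda>w. 1 - of_complex (1 / w) * a)"
      using \<rho>\<tau> by (intro continuous_intros continuous_on_of_complex) (auto simp: K)
  qed (use inv' in \<open>auto simp: K\<close>)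
  have avg: "resolvent_average a \<sigma> n =
      (1 / real n) *\<^sub>R (\<Sum>k<n. G (of_real \<sigma> * cis (2 * pi * (real k / real n))))" for \<sigma> n
    by (simp add: resolvent_average_def G_def)
  define P where "P \<sigma> = lim (resolvent_average a \<sigma>)" for \<sigma>
  have P: "resolvent_average a \<sigma> \<longlonglongrightarrow> P \<sigma>" if "\<rho> \<le> \<sigma>" "\<sigma> \<le> \<tau>" for \<sigma>
  proof -
    have "continuous_on {0..1} (\<lambda>x. G (of_real \<sigma> * cis (2 * pi * x)))"
      using that \<rho>\<tau> by (intro continuous_on_compose2[OF contG] continuous_intros) (auto simp: K norm_mult)
    then have "convergent (resolvent_average a \<sigma>)"
      unfolding avg[abs_def] by (rule riemann_average_convergent)
    then show ?thesis by (simp add: P_def convergent_LIMSEQ_iff)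
  qed
  \<comment> \<open>Pass to the limit in \<open>resolvent_average_mult\<close>, where
    \<open>c\<close> tends to 0 because \<open>\<rho> < \<sigma>\<close>.\<close>
  have PP: "P \<rho> * P \<sigma> = P \<rho>" if "\<rho> < \<sigma>" "\<sigma> \<le> \<tau>" for \<sigma>
  proof -
    define c :: "nat \<Rightarrow> 'a" where "c n = of_complex (of_real ((\<rho> / \<sigma>) ^ n))" for n
    have "(\<lambda>n. (\<rho> / \<sigma>) ^ n) \<longlonglongrightarrow> 0"
      using that \<rho>\<tau> by (intro LIMSEQ_realpow_zero) auto
    then have "c \<longlonglongrightarrow> of_complex (of_real 0)"
      unfolding c_def by (intro tendsto_of_complex tendsto_of_real)
    then have c: "c \<longlonglongrightarrow> 0" by simp
    note lims = P[of \<rho>] P[of \<sigma>] c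
    have l: "(\<lambda>n. (1 - c n) * (resolvent_average a \<rho> n * resolvent_average a \<sigma> n)) \<longlonglongrightarrow> (1 - 0) * (P \<rho> * P \<sigma>)"
      using that \<rho>\<tau> by (intro tendsto_intros lims) auto
    have r: "(\<lambda>n. resolvent_average a \<rho> n - c n * resolvent_average a \<sigma> n) \<longlonglongrightarrow> P \<rho> - 0 * P \<sigma>"
      using that \<rho>\<tau> by (intro tendsto_intros lims) auto
    have "\<forall>\<^sub>F n in sequentially. (1 - c n) * (resolvent_average a \<rho> n * resolvent_average a \<sigma> n)
        = resolvent_average a \<rho> n - c n * resolvent_average a \<sigma> n"
      using eventually_gt_at_top[of 0] unfolding c_def
      by eventually_elim (use that \<rho>\<tau> inv' in \<open>intro resolvent_average_mult; auto\<close>)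
    from LIMSEQ_unique[OF Lim_transform_eventually[OF l this] r] show ?thesis by simp
  qed
  \<comment> \<open>For \<open>\<sigma>\<close> close to \<open>\<rho>\<close> the averages differ
    by at most \<open>e\<close> uniformly in \<open>n\<close>, hence so do their limits, and
    \<open>P \<rho> * P \<rho> - P \<rho> = P \<rho> * (P \<rho> - P \<sigma>)\<close>.\<close>
  have le_small: "norm (P \<rho> * P \<rho> - P \<rho>) \<le> norm (P \<rho>) * e" if "e > 0" for e
  proof -
    have "uniformly_continuous_on K G"
      using contG by (rule compact_uniformly_continuous) (simp add: K_def compact_diff)
    then obtain d where "d > 0"
      and d: "\<And>w w'. w \<in> K \<Longrightarrow> w' \<in> K \<Longrightarrow> dist w' w < d \<Longrightarrow> dist (G w') (G w) < e"
      using \<open>e > 0\<close> unfolding uniformly_continuous_on_def by metis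
    define \<sigma> where "\<sigma> = min \<tau> (\<rho> + d / 2)"
    have \<sigma>: "\<rho> < \<sigma>" "\<sigma> \<le> \<tau>" "\<sigma> - \<rho> < d"
      using \<open>d > 0\<close> \<rho>\<tau> by (auto simp: \<sigma>_def min_def)
    have le: "norm (resolvent_average a \<rho> n - resolvent_average a \<sigma> n) \<le> e" for n
    proof (cases "n = 0")
      case False
      have G: "norm (G (of_real \<rho> * cis x) - G (of_real \<sigma> * cis x)) \<le> e" for x
      proof -
        have "dist (of_real \<rho> * cis x) (of_real \<sigma> * cis x) = \<bar>\<rho> - \<sigma>\<bar>"
          by (simp add: dist_norm norm_mult flip: left_diff_distrib of_real_diff)
        then show ?thesis
          using d[of "of_real \<sigma> * cis x" "of_real \<rho> * cis x"] \<sigma> \<rho>\<tau>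
          by (simp add: K norm_mult dist_norm)
      qed
      have "resolvent_average a \<rho> n - resolvent_average a \<sigma> n =
          (1 / real n) *\<^sub>R (\<Sum>k<n. G (of_real \<rho> * cis (2 * pi * (real k / real n)))
             - G (of_real \<sigma> * cis (2 * pi * (real k / real n))))"
        by (simp add: avg sum_subtractf scaleR_diff_right)
      also have "norm \<dots> \<le> (1 / real n) * (\<Sum>k<n. e)"
        unfolding norm_scaleR by (intro mult_mono sum_norm_le G) auto
      also have "\<dots> = e" using False by simp
      finally show ?thesis .
    qed (use \<open>e > 0\<close> in \<open>simp add: avg\<close>)
    have "norm (P \<rho> - P \<sigma>) \<le> e"
    proof (rule Lim_norm_ubound)
      show "(\<lambda>n. resolvent_average a \<rho> n - resolvent_average a \<sigma> n) \<longlonglongrightarrow> P \<rho> - P \<sigma>"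
        using \<sigma> \<rho>\<tau> by (intro tendsto_diff P) auto
    qed (use le in auto)
    moreover have "P \<rho> * P \<rho> - P \<rho> = P \<rho> * (P \<rho> - P \<sigma>)"
      using PP[of \<sigma>] \<sigma> by (simp add: algebra_simps)
    ultimately show ?thesis
      using norm_mult_ineq[of "P \<rho>" "P \<rho> - P \<sigma>"]
        mult_left_mono[of "norm (P \<rho> - P \<sigma>)" e "norm (P \<rho>)"] by simp
  qed
  have "norm (P \<rho> * P \<rho> - P \<rho>) \<le> 0 + e" if "e > 0" for e
  proof -
    let ?x = "norm (P \<rho>)"
    have "?x + 1 > 0" using norm_ge_zero[of "P \<rho>"] by linarith
    then have "0 < e / (?x + 1)" and "?x * (e / (?x + 1)) \<le> e"
      using that by (simp_all add: field_simps)
    with le_small[of "e / (?x + 1)"] show ?thesis by linarith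
  qed
  then have "P \<rho> * P \<rho> = P \<rho>"
    using field_le_epsilon[of "norm (P \<rho> * P \<rho> - P \<rho>)" 0] by simp
  with P[of \<rho>] \<rho>\<tau> show ?thesis by (intro that[of \<rho> "P \<rho>"]) auto
qed

section \<open>Isolated spectral points and generalized Drazin inverses\<close>

lemma gDrazin_invertible_if_invertible:
  assumes "invertible_el a"
  shows "gDrazin_invertible a"
proof -
  have "quasinilpotent (0 :: 'a)"
    by (rule quasinilpotentI) (simp_all add: invertible_of_complex not_invertible_el_0)
  then show ?thesis
    unfolding gDrazin_invertible_def gDrazin_inverse_def
    by (intro exI[of _ "inv_el a"]) (simp add: inv_el assms)
qed

lemma gDrazin_invertible_imp_isolated:
  fixes a :: "'a::complex_banach_algebra_1"
  assumes "gDrazin_invertible a"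
  shows "\<forall>\<^sub>F z in at 0. invertible_el (of_complex z - a)"
proof -
  obtain b where ab: "a * b = b * a" and bab: "b * a * b = b"
    and qn: "quasinilpotent (a * (1 - a * b))"
    using assms by (auto simp: gDrazin_invertible_def gDrazin_inverse_def)
  define p where "p = 1 - a * b"
  have bp: "b * p = 0" using bab by (simp add: p_def algebra_simps)
  have comm: "p * a = a * p" "p * b = b * p"
    by (simp_all add: p_def left_diff_distrib right_diff_distrib mult.assoc ab)
      (metis ab mult.assoc)+
  have "((\<lambda>z. cmod z * norm b) \<longlongrightarrow> cmod 0 * norm b) (at 0)"
    by (intro tendsto_intros)
  then have "\<forall>\<^sub>F z in at 0. cmod z * norm b < 1"
    by (rule order_tendstoD) simp
  moreover have "\<forall>\<^sub>F z in at (0::complex). z \<noteq> 0"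
    by (simp add: eventually_at_filter)
  ultimately show ?thesis
  proof eventually_elim
    case (elim z)
    \<comment> \<open>\<open>z - a\<close> acts as \<open>z - a p\<close> on the range of \<open>p\<close>, and \<open>b\<close> inverts \<open>a\<close> on the range of \<open>1 - p\<close>.\<close>
    let ?z = "of_complex z :: 'a"
    have za: "x * ?z = ?z * x" for x by (simp add: of_complex_commute)
    have zl: "a * (?z * y) = ?z * (a * y)" "b * (?z * y) = ?z * (b * y)" "p * (?z * y) = ?z * (p * y)" for y
      by (rule of_complex_left_commute)+
    have "a * b = 1 - p" "b * a = 1 - p" by (simp_all add: p_def ab)
    note eqs = left_diff_distrib right_diff_distrib mult.assoc za zl comm bp this
    \<comment> \<open>The cofactor \<open>p - z b\<close> is 1 on the range of \<open>p\<close> and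
      \<open>- z b\<close> on that of \<open>1 - p\<close>, where
      \<open>(z - a) (- z b) = z (1 - z b)\<close>. It commutes with \<open>z - a\<close>, so
      invertibility of the product suffices.\<close>
    have 1: "(?z - a) * (p - ?z * b) = (?z - a * p) * (1 - ?z * b)"
      by (simp add: eqs)
    have 2: "(?z - a) * (p - ?z * b) = (p - ?z * b) * (?z - a)"
      by (simp add: eqs)
    have "norm (?z * b) < 1"
      using elim norm_mult_ineq[of ?z b] by simp
    then have "invertible_el ((?z - a * p) * (1 - ?z * b))"
      using quasinilpotent_imp_invertible[OF qn elim(2)]
      by (intro invertible_el_mult invertible_el_Neumann) (simp_all add: p_def)
    with 1 2 show ?case by (metis invertible_el_factor)
  qed
qed

text \<open>The spectral idempotent \<open>P\<close> at 0 splits \<open>a\<close> into a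
  quasinilpotent part \<open>a * P\<close> and a part with an inverse \<open>b\<close> relative to
  \<open>1 - P\<close>, so that \<open>a * b = 1 - P\<close>. Invertible \<open>a\<close> are
  treated separately, since non-invertibility of \<open>a * P\<close> is inferred from that of
  \<open>a\<close>.\<close>

lemma isolated_imp_gDrazin_invertible:
  fixes a :: "'a::complex_banach_algebra_1"
  assumes "\<forall>\<^sub>F z in at 0. invertible_el (of_complex z - a)"
  shows "gDrazin_invertible a"
proof (cases "invertible_el a")
  case False
  obtain r where r: "r > 0"
    and inv: "\<And>z. z \<noteq> 0 \<Longrightarrow> cmod z < r \<Longrightarrow> invertible_el (of_complex z - a)"
    using assms unfolding eventually_at by auto
  obtain \<rho> P where \<rho>: "0 < \<rho>" "\<rho> < r" and limP: "resolvent_average a \<rho> \<longlonglongrightarrow> P" and PP: "P * P = P"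
    using spectral_idempotent_exists[OF r inv] by blast
  define u where "u = resolvent_average a \<rho>"
  define t where "t = of_complex (1 / of_real \<rho>) * a"
  have inv': "invertible_el (1 - of_complex (1 / w) * a)" if "cmod w = \<rho>" for w
    using inv[of w] that \<rho> by (subst invertible_el_1_minus_iff) auto
  have limu: "u \<longlonglongrightarrow> P" using limP by (simp add: u_def)
  have u_comm: "u n * b = b * u n" if "a * b = b * a" for n b
    unfolding u_def using inv' \<rho>(1) that by (rule resolvent_average_commute)
  have aP: "a * P = P * a"
  proof (rule LIMSEQ_unique)
    show "(\<lambda>n. a * u n) \<longlonglongrightarrow> a * P" "(\<lambda>n. a * u n) \<longlonglongrightarrow> P * a"
      using tendsto_mult[OF tendsto_const limu, of a] tendsto_mult[OF limu tendsto_const, of a]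
      by (simp_all add: u_comm)
  qed
  have tP: "t * P = P * t"
    by (simp add: t_def mult.assoc aP of_complex_left_commute[of P])
  have t_comm: "t * b = b * t" if "a * b = b * a" for b
    using that by (simp add: t_def mult.assoc of_complex_left_commute[of b])
  have uP: "u n * P = P * u n" for n using aP by (rule u_comm)
  have ut: "u n * t = t * u n" for n
    using t_comm by (intro u_comm) simp
  \<comment> \<open>A rearrangement of \<open>(1 - t ^ n) * u n = 1\<close>; it fails at
    \<open>n = 0\<close>, where \<open>u 0 = 0\<close>.\<close>
  have tu: "t ^ n * u n = u n - 1" if "n > 0" for n
  proof -
    have "u n * (1 - t ^ n) = 1"
      unfolding u_def t_def using inv' \<rho>(1) that by (rule resolvent_average_inverse)
    moreover have "t ^ n * u n = u n * t ^ n"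
      using ut power_commuting_commutes by metis
    ultimately show ?thesis by (simp add: algebra_simps)
  qed
  have PPl: "P * (P * x) = P * x" for x by (simp add: PP flip: mult.assoc)

  have "invertible_el (of_complex z - a * P)" if "z \<noteq> 0" for z
  proof (cases "cmod z < r")
    case True
    \<comment> \<open>The complementary factor is \<open>z - a (1 - P)\<close>: the two multiply to \<open>z (z - a)\<close>.\<close>
    let ?z = "of_complex z :: 'a"
    have zc: "a * ?z = ?z * a" "a * (?z * y) = ?z * (a * y)" "P * ?z = ?z * P" "P * (?z * y) = ?z * (P * y)" for y
      by (rule of_complex_commute[symmetric] of_complex_left_commute)+
    have 0: "P * (a * y) = a * (P * y)" for y by (simp add: aP flip: mult.assoc)
    note eqs = left_diff_distrib right_diff_distrib mult.assoc zc PP PPl aP[symmetric] 0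
    have "(?z - a * P) * (?z - a * (1 - P)) = ?z * (?z - a)"
      "(?z - a * (1 - P)) * (?z - a * P) = ?z * (?z - a)"
      by (simp_all add: eqs)
    moreover have "invertible_el (?z * (?z - a))"
      using inv that True by (intro invertible_el_mult invertible_of_complex)
    ultimately show ?thesis by (metis invertible_el_factor)
  next
    case False
    \<comment> \<open>\<open>(a / z)\<^sup>n P\<close> tends to \<open>0\<close>, since \<open>(a / \<rho>)\<^sup>n u\<^sub>n = u\<^sub>n - 1\<close> is bounded, \<open>\<rho> < \<bar>z\<bar>\<close> and \<open>u\<^sub>n P \<rightarrow> P\<close>.\<close>
    define s where "s = of_complex (1 / z) * a"
    define c where "c n = of_complex ((of_real \<rho> / z) ^ n) * (u n - 1) * P" for n
    have s: "s = of_complex (of_real \<rho> / z) * t"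
      using \<rho> by (simp add: s_def t_def flip: of_complex_mult mult.assoc)
    have "cmod (of_real \<rho> / z) < 1"
      using False \<rho> that by (simp add: norm_divide divide_simps)
    then have "(\<lambda>n. (of_real \<rho> / z) ^ n) \<longlonglongrightarrow> 0"
      by (rule LIMSEQ_power_zero)
    from tendsto_of_complex[OF this] have "c \<longlonglongrightarrow> of_complex 0 * (P - 1) * P"
      unfolding c_def by (intro tendsto_mult tendsto_diff tendsto_const limu)
    then have c: "(\<lambda>n. norm (c n)) \<longlonglongrightarrow> 0" by (simp add: tendsto_norm_zero)
    have "(\<lambda>n. P - u n * P) \<longlonglongrightarrow> P - P * P"
      by (intro tendsto_intros limu)
    then have y: "(\<lambda>n. norm (P - u n * P)) \<longlonglongrightarrow> 0" by (simp add: PP tendsto_norm_zero)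
    have "\<forall>\<^sub>F n in sequentially. 0 < n \<and> norm (c n) < 1 / 2 \<and> norm (P - u n * P) < 1 / 2"
      using order_tendstoD(2)[OF c, of "1/2"] order_tendstoD(2)[OF y, of "1/2"]
      by (intro eventually_conj eventually_gt_at_top) auto
    then obtain n where n: "0 < n" "norm (c n) < 1 / 2" "norm (P - u n * P) < 1 / 2"
      using eventually_happens' sequentially_bot by blast
    \<comment> \<open>Splitting \<open>P\<close> into \<open>u n * P\<close> and a remainder of norm
      below 1/2 brings \<open>norm (s ^ n * P)\<close> back on the right with factor 1/2. Absorbing
      it yields a norm below 1, and the Neumann series applies to
      \<open>(s * P) ^ n\<close>.\<close>
    have "s ^ n * P = s ^ n * (u n * P) + s ^ n * P * (P - u n * P)"
      by (simp add: right_diff_distrib mult.assoc PP PPl uP)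
    also have "s ^ n * (u n * P) = c n"
      by (simp add: s power_mult_of_complex c_def mult.assoc tu[OF n(1), symmetric])
    finally have "norm (s ^ n * P) = norm (c n + s ^ n * P * (P - u n * P))"
      by (rule arg_cong)
    then have "norm (s ^ n * P) \<le> norm (c n) + norm (s ^ n * P) * norm (P - u n * P)"
      using norm_triangle_ineq[of "c n" "s ^ n * P * (P - u n * P)"]
        norm_mult_ineq[of "s ^ n * P" "P - u n * P"] by linarith
    also have "\<dots> \<le> norm (c n) + norm (s ^ n * P) * (1 / 2)"
      using n by (intro add_left_mono mult_left_mono) auto
    finally have "norm (s ^ n * P) < 1" using n by simp
    moreover have "s * P = P * s"
      by (simp add: s_def mult.assoc aP of_complex_left_commute[of P])
    then have "(s * P) ^ n = s ^ n * P ^ n"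
      by (rule power_mult_distrib_commuting)
    moreover have "P ^ n = P"
      using n(1) PP by (induction n rule: nat_induct_non_zero) auto
    ultimately have "invertible_el (1 - (s * P) ^ n)"
      by (simp add: invertible_el_Neumann)
    then have "invertible_el (1 - of_complex (1 / z) * (a * P))"
      by (metis invertible_el_1_minus_if_power s_def mult.assoc)
    then show ?thesis using invertible_el_1_minus_iff that by blast
  qed
  moreover have "\<not> invertible_el (a * P)"
    using False aP invertible_el_factor by blast
  ultimately have qn: "quasinilpotent (a * P)" by (rule quasinilpotentI)

  \<comment> \<open>The element \<open>y = P - (u n - 1) * (1 - P)\<close> tends to 1, hence is
    invertible for some \<open>n > 0\<close>, and
    \<open>(1 - P) * y = - t ^ n * u n * (1 - P)\<close>. Dividing by \<open>y\<close> and splitting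
    off one factor \<open>t = a / \<rho>\<close> leads to \<open>b\<close>.\<close>
  have "(\<lambda>n. P - (u n - 1) * (1 - P)) \<longlonglongrightarrow> P - (P - 1) * (1 - P)"
    by (intro tendsto_intros limu)
  moreover have "P - (P - 1) * (1 - P) = 1" by (simp add: algebra_simps PP)
  ultimately have "(\<lambda>n. norm (1 - (P - (u n - 1) * (1 - P)))) \<longlonglongrightarrow> norm (1 - 1 :: 'a)"
    by (intro tendsto_norm tendsto_diff tendsto_const) simp
  then have "\<forall>\<^sub>F n in sequentially. 0 < n \<and> norm (1 - (P - (u n - 1) * (1 - P))) < 1"
    by (intro eventually_conj eventually_gt_at_top order_tendstoD(2)[of _ "norm (1 - 1 :: 'a)"]) auto
  then obtain n where n: "0 < n" and "norm (1 - (P - (u n - 1) * (1 - P))) < 1"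
    using eventually_happens' sequentially_bot by blast
  then have inv_y: "invertible_el (P - (u n - 1) * (1 - P))"
    using invertible_el_Neumann by fastforce
  define y' where "y' = inv_el (P - (u n - 1) * (1 - P))"
  define b where "b = - of_complex (1 / of_real \<rho>) * (t ^ (n - 1) * u n * (1 - P) * y')"
  have y'_comm: "y' * x = x * y'" if "a * x = x * a" "P * x = x * P" for x
    unfolding y'_def using that u_comm[of x n]
    by (intro inv_el_commute[OF inv_y]) (simp add: algebra_simps; simp flip: mult.assoc)
  have y'a: "y' * a = a * y'" and y'P: "y' * P = P * y'"
    using aP by (auto intro: y'_comm)
  have "a * b = - (t * t ^ (n - 1) * u n * (1 - P) * y')"
    by (simp add: b_def t_def mult.assoc of_complex_left_commute[of a])
  also have "t * t ^ (n - 1) * u n = u n - 1"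
    using n tu[of n] by (simp flip: power_Suc)
  also have "- ((u n - 1) * (1 - P) * y') = (1 - P) * (P - (u n - 1) * (1 - P)) * y'"
    by (simp add: algebra_simps PP PPl uP)
  also have "\<dots> = 1 - P"
    using inv_el_right[OF inv_y] by (simp add: y'_def mult.assoc)
  finally have ab: "a * b = 1 - P" .
  have tna: "t ^ (n - 1) * a = a * t ^ (n - 1)"
    using t_comm by (intro power_commuting_commutes) simp
  have "b * a = a * b"
  proof -
    have "w * a = a * w \<Longrightarrow> x * a = a * x \<Longrightarrow> w * x * a = a * (w * x)" for w x
      by (metis mult.assoc)
    then show ?thesis
      unfolding b_def using aP y'a u_comm[of a n] tna
      by (simp add: of_complex_commute left_diff_distrib right_diff_distrib)
  qed
  \<comment> \<open>\<open>y'\<close> commutes with \<open>P\<close>, so \<open>b * P\<close>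
    contains \<open>(1 - P) * P = 0\<close>; hence \<open>b * a * b = b * (1 - P) = b\<close>.
    Finally \<open>a * (1 - a * b) = a * P\<close>.\<close>
  moreover have "b * P = 0"
    by (simp add: b_def mult.assoc y'P) (simp add: left_diff_distrib PPl)
  then have "b * a * b = b"
    by (simp add: mult.assoc ab) (simp add: right_diff_distrib)
  ultimately show ?thesis
    unfolding gDrazin_invertible_def gDrazin_inverse_def using qn
    by (intro exI[of _ b]) (simp add: ab)
qed (rule gDrazin_invertible_if_invertible)

theorem gDrazin_invertible_iff_isolated:
  "gDrazin_invertible a \<longleftrightarrow> (\<forall>\<^sub>F z in at 0. invertible_el (of_complex z - a))"
  using gDrazin_invertible_imp_isolated isolated_imp_gDrazin_invertible by blast

section \<open>The cubic identity\<close>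

text \<open>Scalars are central, and expanding the ordered product yields \<open>x1 * x2\<close>,
  \<open>x1 * x3\<close>, \<open>x2 * x3\<close> and \<open>x1 * x2 * x3\<close> in exactly the
  order of the hypotheses.\<close>

lemma cubic_identity:
  fixes x1 x2 x3 :: "'a::complex_banach_algebra_1"
  assumes "x1 * x2 + x1 * x3 + x2 * x3 = scaleC \<alpha>1 1 + scaleC \<alpha>2 (x1 + x2 + x3)"
    and "x1 * x2 * x3 = scaleC \<beta> (x1 + x2 + x3)"
  shows "(of_complex z - x1) * (of_complex z - x2) * (of_complex z - x3) =
    of_complex (z ^ 3 + \<alpha>1 * z) - of_complex (z ^ 2 - \<alpha>2 * z + \<beta>) * (x1 + x2 + x3)"
proof -
  let ?z = "of_complex z :: 'a" and ?s = "x1 + x2 + x3"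
  have zc: "x1 * ?z = ?z * x1" "x2 * ?z = ?z * x2" "x3 * ?z = ?z * x3"
    "x1 * (?z * y) = ?z * (x1 * y)" "x2 * (?z * y) = ?z * (x2 * y)" for y
    by (rule of_complex_commute[symmetric] of_complex_left_commute)+
  have "(?z - x1) * (?z - x2) * (?z - x3) =
      ?z * ?z * ?z - ?z * ?z * ?s + ?z * (x1 * x2 + x1 * x3 + x2 * x3) - x1 * x2 * x3"
    by (simp add: algebra_simps zc)
  also have "\<dots> = of_complex (z ^ 3 + \<alpha>1 * z) - of_complex (z ^ 2 - \<alpha>2 * z + \<beta>) * ?s"
    unfolding assms scaleC_conv_of_complex
    by (simp add: of_complex_add of_complex_diff of_complex_mult power3_eq_cube power2_eq_square
        left_diff_distrib distrib_left distrib_right mult.assoc of_complex_commute[of \<alpha>1 ?z]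
        of_complex_left_commute[of ?z \<alpha>2] flip: of_complex_def)
  finally show ?thesis .
qed

text \<open>For \<open>\<beta> \<noteq> 0\<close> the denominator does not vanish at 0. For
  \<open>\<beta> = \<alpha>1 = 0\<close> a factor \<open>z\<close> cancels, leaving
  \<open>z^2 / (z - \<alpha>2)\<close>, which reduces to \<open>z\<close> if
  \<open>\<alpha>2 = 0\<close>. In the excluded case the quotient
  \<open>(z^2 + \<alpha>1) / (z - \<alpha>2)\<close> has a pole or a nonzero value at 0.\<close>

lemma cubic_quotient_local:
  fixes \<alpha>1 \<alpha>2 \<beta> :: complex
  assumes "\<beta> \<noteq> 0 \<or> \<alpha>1 = 0"
  obtains f r where "r > 0" "f holomorphic_on ball 0 r" "f 0 = 0"
    "\<And>z. z \<noteq> 0 \<Longrightarrow> cmod z < r \<Longrightarrow> f z \<noteq> 0 \<and> z ^ 2 - \<alpha>2 * z + \<beta> \<noteq> 0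
       \<and> z ^ 3 + \<alpha>1 * z = (z ^ 2 - \<alpha>2 * z + \<beta>) * f z"
proof -
  consider "\<beta> \<noteq> 0" | "\<beta> = 0" "\<alpha>1 = 0" "\<alpha>2 \<noteq> 0" | "\<beta> = 0" "\<alpha>1 = 0" "\<alpha>2 = 0"
    using assms by blast
  then show ?thesis
  proof cases
    case 1
    have "((\<lambda>z. z ^ 2 - \<alpha>2 * z + \<beta>) \<longlongrightarrow> 0 ^ 2 - \<alpha>2 * 0 + \<beta>) (at 0)"
      by (intro tendsto_intros)
    then have q: "\<forall>\<^sub>F z in at 0. z ^ 2 - \<alpha>2 * z + \<beta> \<noteq> 0"
      by (rule tendsto_imp_eventually_ne) (use 1 in simp)
    \<comment> \<open>The numerator is \<open>z (z^2 + \<alpha>1)\<close>, so this keeps the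
      quotient nonzero off the origin.\<close>
    have n: "\<forall>\<^sub>F z in at 0. z ^ 2 + \<alpha>1 \<noteq> 0"
    proof (cases "\<alpha>1 = 0")
      case False
      have "((\<lambda>z. z ^ 2 + \<alpha>1) \<longlongrightarrow> 0 ^ 2 + \<alpha>1) (at 0)"
        by (intro tendsto_intros)
      then show ?thesis by (rule tendsto_imp_eventually_ne) (use False in simp)
    qed (simp add: eventually_at_filter)
    obtain r where r: "r > 0"
      "\<And>z. z \<noteq> 0 \<Longrightarrow> cmod z < r \<Longrightarrow> z ^ 2 - \<alpha>2 * z + \<beta> \<noteq> 0 \<and> z ^ 2 + \<alpha>1 \<noteq> 0"
      using eventually_conj[OF q n] unfolding eventually_at by auto
    have q': "z ^ 2 - \<alpha>2 * z + \<beta> \<noteq> 0" if "cmod z < r" for z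
      using r(2)[of z] that 1 by (cases "z = 0") auto
    have n': "z ^ 3 + \<alpha>1 * z \<noteq> 0" if "z \<noteq> 0" "cmod z < r" for z
    proof -
      have "z ^ 3 + \<alpha>1 * z = z * (z ^ 2 + \<alpha>1)" by algebra
      then show ?thesis using r(2)[of z] that by simp
    qed
    show ?thesis
    proof (rule that[of r "\<lambda>z. (z ^ 3 + \<alpha>1 * z) / (z ^ 2 - \<alpha>2 * z + \<beta>)"])
      show "(\<lambda>z. (z ^ 3 + \<alpha>1 * z) / (z ^ 2 - \<alpha>2 * z + \<beta>)) holomorphic_on ball 0 r"
        using q' by (intro holomorphic_intros) auto
    qed (use r(1) q' n' in auto)
  next
    case 2
    have ne: "z - \<alpha>2 \<noteq> 0" if "cmod z < cmod \<alpha>2" for z using that by auto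
    show ?thesis
    proof (rule that[of "cmod \<alpha>2" "\<lambda>z. z ^ 2 / (z - \<alpha>2)"])
      show "(\<lambda>z. z ^ 2 / (z - \<alpha>2)) holomorphic_on ball 0 (cmod \<alpha>2)"
        using ne by (intro holomorphic_intros) auto
    next
      fix z assume z: "z \<noteq> 0" "cmod z < cmod \<alpha>2"
      have "z ^ 2 - \<alpha>2 * z + \<beta> = z * (z - \<alpha>2)"
        using 2 by (simp add: algebra_simps power2_eq_square)
      then show "z ^ 2 / (z - \<alpha>2) \<noteq> 0 \<and> z ^ 2 - \<alpha>2 * z + \<beta> \<noteq> 0
          \<and> z ^ 3 + \<alpha>1 * z = (z ^ 2 - \<alpha>2 * z + \<beta>) * (z ^ 2 / (z - \<alpha>2))"
        using 2 z ne[OF z(2)] by (simp add: power2_eq_square power3_eq_cube)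
    qed (use 2 in auto)
  next
    case 3
    then show ?thesis
      by (intro that[of 1 "\<lambda>z. z"]) (auto simp: power2_eq_square power3_eq_cube)
  qed
qed

text \<open>From left to right, the open mapping theorem makes the image of a small disc a
  neighbourhood of 0, and its nonzero points come from nonzero \<open>z\<close> because
  \<open>f 0 = 0\<close>. From right to left, \<open>f\<close> tends to 0 and avoids 0 off the
  origin.\<close>

lemma eventually_at_0_holomorphic_iff:
  assumes r: "r > 0" and f: "f holomorphic_on ball 0 r" "f 0 = 0"
    and nz: "\<And>z. z \<noteq> 0 \<Longrightarrow> cmod z < r \<Longrightarrow> f z \<noteq> 0"
  shows "(\<forall>\<^sub>F z in at 0. Q (f z)) \<longleftrightarrow> (\<forall>\<^sub>F w in at 0. Q w)"
proof
  assume "\<forall>\<^sub>F z in at 0. Q (f z)"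
  then obtain d where d: "d > 0" "\<And>z. z \<noteq> 0 \<Longrightarrow> cmod z < d \<Longrightarrow> Q (f z)"
    unfolding eventually_at by auto
  define U where "U = ball (0::complex) (min d r)"
  have "\<not> f constant_on ball 0 r"
  proof
    assume "f constant_on ball 0 r"
    then obtain c where c: "\<And>z. z \<in> ball 0 r \<Longrightarrow> f z = c" by (auto simp: constant_on_def)
    have "f (of_real (r / 2)) = f 0" using c r by simp
    with nz[of "of_real (r / 2)"] f r show False by simp
  qed
  then have "open (f ` U)"
    using f by (intro open_mapping_thm[of f "ball 0 r" U]) (auto simp: U_def)
  moreover have "0 \<in> f ` U"
    using f d r by (intro image_eqI[of _ _ 0]) (auto simp: U_def)
  moreover have "Q w" if "w \<in> f ` U" "w \<noteq> 0" for w
  proof -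
    obtain x where x: "w = f x" "cmod x < d" using \<open>w \<in> f ` U\<close> by (auto simp: U_def)
    then have "x \<noteq> 0" using f \<open>w \<noteq> 0\<close> by auto
    with x d show ?thesis by simp
  qed
  ultimately show "\<forall>\<^sub>F w in at 0. Q w"
    unfolding eventually_at_topological by blast
next
  assume Q: "\<forall>\<^sub>F w in at 0. Q w"
  have "isCont f 0"
    using holomorphic_on_imp_continuous_on[OF f(1)] r by (simp add: continuous_on_eq_continuous_at)
  then have "f \<midarrow>0\<rightarrow> 0" using f by (simp add: isCont_def)
  moreover have "\<forall>\<^sub>F z in at 0. f z \<noteq> 0"
    unfolding eventually_at using r nz by auto
  ultimately have "filterlim f (at 0) (at 0)" by (simp add: filterlim_at)
  with Q show "\<forall>\<^sub>F z in at 0. Q (f z)" by (rule eventually_compose_filterlim)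
qed

theorem theorem2p2:
  fixes x1 x2 x3 :: "'a::complex_banach_algebra_1"
    and \<alpha>1 \<alpha>2 \<beta> :: complex
  assumes h1: "x1 * x2 + x1 * x3 + x2 * x3 = scaleC \<alpha>1 1 + scaleC \<alpha>2 (x1 + x2 + x3)"
    and h2: "x1 * x2 * x3 = scaleC \<beta> (x1 + x2 + x3)"
    and hM: "(\<alpha>1, \<alpha>2, \<beta>) \<notin> M_set"
  shows "(gDrazin_invertible x1 \<and> gDrazin_invertible x2 \<and> gDrazin_invertible x3
            \<longrightarrow> gDrazin_invertible (x1 + x2 + x3))
       \<and> (gDrazin_invertible x1 \<and> gDrazin_invertible x2 \<and> gDrazin_invertible (x1 + x2 + x3)
            \<longrightarrow> gDrazin_invertible x3)
       \<and> (gDrazin_invertible x1 \<and> gDrazin_invertible x3 \<and> gDrazin_invertible (x1 + x2 + x3)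
            \<longrightarrow> gDrazin_invertible x2)
       \<and> (gDrazin_invertible x2 \<and> gDrazin_invertible x3 \<and> gDrazin_invertible (x1 + x2 + x3)
            \<longrightarrow> gDrazin_invertible x1)"
proof -
  let ?s = "x1 + x2 + x3"
  let ?prod = "\<lambda>z. (of_complex z - x1) * (of_complex z - x2) * (of_complex z - x3)"
  \<comment> \<open>The two sets in \<open>M_set\<close> together say \<open>\<beta> = 0\<close> and
    \<open>\<alpha>1 \<noteq> 0\<close>, split by whether \<open>\<alpha>2\<close> vanishes.\<close>
  have "\<beta> \<noteq> 0 \<or> \<alpha>1 = 0" using hM by (auto simp: M_set_def)
  then obtain f r where r: "r > 0" and f: "f holomorphic_on ball 0 r" "f 0 = 0"
    and quot: "\<And>z. z \<noteq> 0 \<Longrightarrow> cmod z < r \<Longrightarrow> f z \<noteq> 0 \<and> z ^ 2 - \<alpha>2 * z + \<beta> \<noteq> 0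
       \<and> z ^ 3 + \<alpha>1 * z = (z ^ 2 - \<alpha>2 * z + \<beta>) * f z"
    using cubic_quotient_local by metis
  have "\<forall>\<^sub>F z in at 0. invertible_el (?prod z) \<longleftrightarrow> invertible_el (of_complex (f z) - ?s)"
  proof -
    have "invertible_el (?prod z) \<longleftrightarrow> invertible_el (of_complex (f z) - ?s)"
      if "z \<noteq> 0" "cmod z < r" for z
    proof -
      have "?prod z = of_complex (z ^ 2 - \<alpha>2 * z + \<beta>) * (of_complex (f z) - ?s)"
        unfolding cubic_identity[OF h1 h2] using quot[OF that]
        by (simp add: right_diff_distrib of_complex_mult)
      then show ?thesis
        using quot[OF that] by (metis invertible_el_mult_iff_right invertible_of_complex)
    qed
    then show ?thesis unfolding eventually_at using r by auto
  qed
  then have "(\<forall>\<^sub>F z in at 0. invertible_el (?prod z)) \<longleftrightarrow>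
      (\<forall>\<^sub>F z in at 0. invertible_el (of_complex (f z) - ?s))"
    by (rule eventually_subst)
  also have "\<dots> \<longleftrightarrow> (\<forall>\<^sub>F w in at 0. invertible_el (of_complex w - ?s))"
    using r f quot by (intro eventually_at_0_holomorphic_iff) auto
  finally have s: "gDrazin_invertible ?s \<longleftrightarrow> (\<forall>\<^sub>F z in at 0. invertible_el (?prod z))"
    by (simp add: gDrazin_invertible_iff_isolated)
  \<comment> \<open>What remains is pointwise in \<open>z\<close>: a product of invertible factors
    is invertible, and if the product and two factors are invertible, cancelling these leaves the
    third.\<close>
  show ?thesis
    unfolding s unfolding gDrazin_invertible_iff_isolated
  proof (intro conjI impI; elim conjE)
    assume "\<forall>\<^sub>F z in at 0. invertible_el (of_complex z - x1)"
      "\<forall>\<^sub>F z in at 0. invertible_el (of_complex z - x2)"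
      "\<forall>\<^sub>F z in at 0. invertible_el (of_complex z - x3)"
    then show "\<forall>\<^sub>F z in at 0. invertible_el (?prod z)"
      by eventually_elim (intro invertible_el_mult)
  next
    assume "\<forall>\<^sub>F z in at 0. invertible_el (of_complex z - x1)"
      "\<forall>\<^sub>F z in at 0. invertible_el (of_complex z - x2)" "\<forall>\<^sub>F z in at 0. invertible_el (?prod z)"
    then show "\<forall>\<^sub>F z in at 0. invertible_el (of_complex z - x3)"
      by eventually_elim (simp add: invertible_el_mult invertible_el_mult_iff_right)
  next
    assume "\<forall>\<^sub>F z in at 0. invertible_el (of_complex z - x1)"
      "\<forall>\<^sub>F z in at 0. invertible_el (of_complex z - x3)" "\<forall>\<^sub>F z in at 0. invertible_el (?prod z)"
    then show "\<forall>\<^sub>F z in at 0. invertible_el (of_complex z - x2)"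
      by eventually_elim (simp add: invertible_el_mult_iff_left invertible_el_mult_iff_right)
  next
    assume "\<forall>\<^sub>F z in at 0. invertible_el (of_complex z - x2)"
      "\<forall>\<^sub>F z in at 0. invertible_el (of_complex z - x3)" "\<forall>\<^sub>F z in at 0. invertible_el (?prod z)"
    then show "\<forall>\<^sub>F z in at 0. invertible_el (of_complex z - x1)"
      by eventually_elim (simp add: invertible_el_mult_iff_left)
  qed
qed

end
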